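(* Consider a radial multi-phase network with data $\mathcal{T}=(\mathcal{N}^+,\mathcal{E})$, $(\Phi_j)$, $(\Phi_{ij})$, $(z_{ij})$ as in the context. Fix power injections $s_j\in\mathbb{C}^{|\Phi_j|}$, $j\in\mathcal{N}$, and a slack-bus voltage matrix $v_0$. Let $(\hat v,\hat S,\hat\Lambda)$ satisfy the linearized (lossless) model with $\hat v_0=v_0$: $$\hat v_j=\hat v_i^{\Phi_{ij}}-\big(\hat S_{ij}z_{ij}^H+z_{ij}\hat S_{ij}^H\big),\qquad \hat S_{ij}=\gamma^{\Phi_{ij}}\operatorname{Diag}(\hat\Lambda_{ij}),\qquad\forall (i,j)\in\mathcal{E},$$ $$\hat\Lambda_{ij}-\sum_{k:(j,k)\in\mathcal{E}}\hat\Lambda_{jk}^{\Phi_j}=-s_j,\qquad\forall j\in\mathcal{N}^+.$$ Let $(v,S,\Lambda,\ell)$ satisfy, with the same $v_0$ and the same injections $s_j$, $j\in\mathcal{N}$, the intermediate model, which keeps the power losses: $$v_j=v_i^{\Phi_{ij}}-\big(S_{ij}z_{ij}^H+z_{ij}S_{ij}^H\big)+z_{ij}\ell_{ij}z_{ij}^H,\qquad S_{ij}=\gamma^{\Phi_{ij}}\operatorname{Diag}(\Lambda_{ij}),\qquad\forall (i,j)\in\mathcal{E},$$ $$\Lambda_{ij}-\sum_{k:(j,k)\in\mathcal{E}}\Lambda_{jk}^{\Phi_j}=-s_j+\operatorname{diag}(z_{ij}\ell_{ij}),\qquad\forall j\in\mathcal{N}^+.$$ Then for every bus $h\in\mathcal{N}$,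 the difference between $\hat v_h$ predicted by the linearized model and $v_h$ given by the intermediate model is $$\hat v_h-v_h=\sum_{(\zeta,\xi)\in\mathbb{P}_h}\Big(M_{\zeta\xi}z_{\zeta\xi}^H+z_{\zeta\xi}M_{\zeta\xi}^H-z_{\zeta\xi}\ell_{\zeta\xi}z_{\zeta\xi}^H\Big),$$ where $M_{\zeta\xi}$ depends on the power losses downstream of bus $\xi$ as $$M_{\zeta\xi}=\gamma^{\Phi_{\zeta\xi}}\operatorname{Diag}\big(\operatorname{diag}(z_{\zeta\xi}\ell_{\zeta\xi})\big)+\sum_{(\alpha,\beta)\in\operatorname{down}(\xi)}\gamma^{\Phi_{\alpha\beta}}\operatorname{Diag}\big(\operatorname{diag}(z_{\alpha\beta}\ell_{\alpha\beta})\big).$$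
   Context: Network: $\mathcal{T}=(\mathcal{N}^+,\mathcal{E})$ is a finite directed tree, $\mathcal{N}^+=\{0\}\cup\mathcal{N}$, $\mathcal{N}=\{1,\dots,N\}$, rooted at the slack bus $0$, with all lines $(i,j)\in\mathcal{E}$ pointing away from the root, so that each $j\in\mathcal{N}$ has a unique upstream bus $i$. Each bus $j$ has a phase set $\Phi_j\subseteq\{a,b,c\}$ and each line $(i,j)$ has a phase set $\Phi_{ij}$, with $\Phi_{ij}=\Phi_j\subseteq\Phi_i$. Each line has a series impedance matrix $z_{ij}\in\mathbb{C}^{|\Phi_{ij}|\times|\Phi_{ij}|}$. In the balance equations, $i$ is the upstream bus of $j$; for $j=0$ the terms carrying the index $ij$ are absent, and the equation just determines the slack injection $s_0$ in each model. Variables: $v_j,\hat v_j\in\mathbb{C}^{|\Phi_j|\times|\Phi_j|}$ are voltage matrices (physically $v_j=V_jV_j^H$ with $V_j$ the vector of complex phase voltages). $S_{ij},\hat S_{ij},\ell_{ij}\in\mathbb{C}^{|\Phi_{ij}|\times|\Phi_{ij}|}$, where $\ell_{ij}=I_{ij}I_{ij}^H$ with $I_{ij}$ the vector of complex phase currents. $\Lambda_{ij},\hat\Lambda_{ij}\in\mathbb{C}^{|\Phi_{ij}|}$ are the sending-end line power flows. Notation: $(\cdot)^H$ is the conjugate transpose; $\operatorname{diag}(\cdot)$ is the column vector of diagonal entries of a matrix; $\operatorname{Diag}(\cdot)$ is the diagonal matrix built from a vector. For a phase set $\Phi$, a superscript $\Phi$ on a matrix or vector denotes its restriction to the phases in $\Phi$,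 or, if it is indexed by a smaller phase set, its extension to $\Phi$ by zeros. When matrices indexed by different phase sets are added, they are understood as matched in this way: in the sum defining $M_{\zeta\xi}$ each summand is extended by zeros to $\Phi_{\zeta\xi}$, and in the formula for $\hat v_h-v_h$ each summand is restricted to $\Phi_h$. The constant matrix is $\gamma=\beta\beta^H\in\mathbb{C}^{3\times3}$, with $\beta=(1,\alpha,\alpha^2)^\top$ and $\alpha=e^{-\mathbf{i}2\pi/3}$, rows and columns indexed by $a,b,c$ (in the sum defining $M_{\zeta\xi}$, the pair $(\alpha,\beta)$ is instead the index of a line). $\mathbb{P}_h$ is the set of lines on the unique path between bus $h$ and the root. $\operatorname{down}(\xi)$ is the set of all lines lying downstream of bus $\xi$, i.e. in the subtree rooted at $\xi$.
   Formalization: The stated M fails if a downstream line has fewer phases; proved for all h with each loss vector diag(zℓ) extended by zeros to Φ_ζξ, then multiplied by γ^{Φ_ζξ}; the literal zero-extended M is proved only for h with Φ_h ⊆ Φ_αβ for all lines (α,β) in down(ξ), for all (ζ,ξ) in P_h. *)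

theory Defs
  imports "HOL-Analysis.Analysis"
begin

datatype phase = PhaseA | PhaseB | PhaseC

instance phase :: finite
proof
  have "(UNIV :: phase set) = {PhaseA, PhaseB, PhaseC}"
    using phase.exhaust by auto
  then show "finite (UNIV :: phase set)"
    by (metis finite.emptyI finite.insertI)
qed

text \<open>
  A vector or matrix indexed by a phase set \<open>F\<close> is represented by its zero padding to all
  three phases, that is, by a \<open>phase\<close>-indexed object supported on \<open>F\<close> (resp. \<open>F \<times> F\<close>).
  Sums, products and conjugate transposes of \<open>F\<close>-indexed objects are those of the paddings,
  extension by zeros to a larger phase set is the identity on representatives, and restriction
  to \<open>F\<close> zeroes all entries outside \<open>F\<close>.  So \<open>vrestr F\<close> and \<open>mrestr F\<close> render
  the superscript \<open>F\<close> in both of its uses (restriction and extension by zeros).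
\<close>

type_synonym cvec = "complex ^ phase"
type_synonym cmat = "complex ^ phase ^ phase"

definition vrestr :: "phase set \<Rightarrow> cvec \<Rightarrow> cvec" where
  "vrestr F x = (\<chi> p. if p \<in> F then x $ p else 0)"

definition mrestr :: "phase set \<Rightarrow> cmat \<Rightarrow> cmat" where
  "mrestr F A = (\<chi> p q. if p \<in> F \<and> q \<in> F then A $ p $ q else 0)"

definition vec_on :: "phase set \<Rightarrow> cvec \<Rightarrow> bool" where
  "vec_on F x \<longleftrightarrow> (\<forall>p. p \<notin> F \<longrightarrow> x $ p = 0)"

definition mat_on :: "phase set \<Rightarrow> cmat \<Rightarrow> bool" where
  "mat_on F A \<longleftrightarrow> (\<forall>p q. p \<notin> F \<or> q \<notin> F \<longrightarrow> A $ p $ q = 0)"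

definition herm :: "cmat \<Rightarrow> cmat" where
  "herm A = (\<chi> p q. cnj (A $ q $ p))"

definition diag_vec :: "cmat \<Rightarrow> cvec" where
  "diag_vec A = (\<chi> p. A $ p $ p)"

definition Diag_mat :: "cvec \<Rightarrow> cmat" where
  "Diag_mat x = (\<chi> p q. if p = q then x $ p else 0)"

definition alpha :: complex where
  "alpha = exp (- (\<i> * 2 * of_real pi / 3))"

definition beta :: cvec where
  "beta = (\<chi> p. case p of PhaseA \<Rightarrow> 1 | PhaseB \<Rightarrow> alpha | PhaseC \<Rightarrow> alpha ^ 2)"

definition gamma :: cmat where
  "gamma = (\<chi> p q. beta $ p * cnj (beta $ q))"

fun walk :: "(nat \<times> nat) set \<Rightarrow> nat \<Rightarrow> (nat \<times> nat) list \<Rightarrow> nat \<Rightarrow> bool" where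
  "walk E u [] w \<longleftrightarrow> u = w"
| "walk E u (e # es) w \<longleftrightarrow> e \<in> E \<and> fst e = u \<and> walk E (snd e) es w"

text \<open>
  A directed tree rooted at \<open>0\<close> with all lines pointing away from the root: every bus is
  reached from the root by exactly one directed walk.  This excludes cycles, and gives every
  bus other than \<open>0\<close> exactly one upstream bus and \<open>0\<close> none.
\<close>

definition rooted_tree :: "nat \<Rightarrow> (nat \<times> nat) set \<Rightarrow> bool" where
  "rooted_tree N E \<longleftrightarrow> E \<subseteq> {0..N} \<times> {0..N} \<and> (\<forall>j\<in>{0..N}. \<exists>!es. walk E 0 es j)"

definition path_lines :: "(nat \<times> nat) set \<Rightarrow> nat \<Rightarrow> (nat \<times> nat) set" where
  "path_lines E h = {e. \<exists>es. walk E 0 es h \<and> e \<in> set es}"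

definition down :: "(nat \<times> nat) set \<Rightarrow> nat \<Rightarrow> (nat \<times> nat) set" where
  "down E x = {(a, b) \<in> E. \<exists>es. walk E x es a}"

text \<open>
  \<open>Phi j\<close> are the phases of bus \<open>j\<close>, \<open>Psi i j\<close> those of line \<open>(i, j)\<close>, and \<open>z i j\<close> is the
  series impedance matrix of that line.
\<close>

definition radial_network ::
  "nat \<Rightarrow> (nat \<times> nat) set \<Rightarrow> (nat \<Rightarrow> phase set) \<Rightarrow> (nat \<Rightarrow> nat \<Rightarrow> phase set)
    \<Rightarrow> (nat \<Rightarrow> nat \<Rightarrow> cmat) \<Rightarrow> bool" where
  "radial_network N E Phi Psi z \<longleftrightarrow>
     rooted_tree N E \<and>
     (\<forall>(i, j)\<in>E. Psi i j = Phi j \<and> Phi j \<subseteq> Phi i \<and> mat_on (Psi i j) (z i j))"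

text \<open>
  In both models \<open>s\<close> gives the injections at all buses, the slack bus \<open>0\<close> included.  As every
  bus \<open>j \<noteq> 0\<close> has exactly one upstream bus \<open>i\<close>, the balance equations for these buses are
  indexed by the lines \<open>(i, j)\<close>; the balance equation of bus \<open>0\<close> has no upstream terms.
\<close>

definition linearized_model ::
  "nat \<Rightarrow> (nat \<times> nat) set \<Rightarrow> (nat \<Rightarrow> phase set) \<Rightarrow> (nat \<Rightarrow> nat \<Rightarrow> phase set)
    \<Rightarrow> (nat \<Rightarrow> nat \<Rightarrow> cmat) \<Rightarrow> (nat \<Rightarrow> cvec)
    \<Rightarrow> (nat \<Rightarrow> cmat) \<Rightarrow> (nat \<Rightarrow> nat \<Rightarrow> cmat) \<Rightarrow> (nat \<Rightarrow> nat \<Rightarrow> cvec) \<Rightarrow> bool" where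
  "linearized_model N E Phi Psi z s v S L \<longleftrightarrow>
     (\<forall>j\<in>{0..N}. vec_on (Phi j) (s j) \<and> mat_on (Phi j) (v j)) \<and>
     (\<forall>(i, j)\<in>E. mat_on (Psi i j) (S i j) \<and> vec_on (Psi i j) (L i j)) \<and>
     (\<forall>(i, j)\<in>E.
        v j = mrestr (Psi i j) (v i) - (S i j ** herm (z i j) + z i j ** herm (S i j)) \<and>
        S i j = mrestr (Psi i j) gamma ** Diag_mat (L i j)) \<and>
     (\<forall>(i, j)\<in>E. L i j - (\<Sum>k\<in>{k. (j, k) \<in> E}. vrestr (Phi j) (L j k)) = - s j) \<and>
     - (\<Sum>k\<in>{k. (0, k) \<in> E}. vrestr (Phi 0) (L 0 k)) = - s 0"

definition intermediate_model ::
  "nat \<Rightarrow> (nat \<times> nat) set \<Rightarrow> (nat \<Rightarrow> phase set) \<Rightarrow> (nat \<Rightarrow> nat \<Rightarrow> phase set)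
    \<Rightarrow> (nat \<Rightarrow> nat \<Rightarrow> cmat) \<Rightarrow> (nat \<Rightarrow> cvec)
    \<Rightarrow> (nat \<Rightarrow> cmat) \<Rightarrow> (nat \<Rightarrow> nat \<Rightarrow> cmat) \<Rightarrow> (nat \<Rightarrow> nat \<Rightarrow> cvec) \<Rightarrow> (nat \<Rightarrow> nat \<Rightarrow> cmat)
    \<Rightarrow> bool" where
  "intermediate_model N E Phi Psi z s v S L l \<longleftrightarrow>
     (\<forall>j\<in>{0..N}. vec_on (Phi j) (s j) \<and> mat_on (Phi j) (v j)) \<and>
     (\<forall>(i, j)\<in>E. mat_on (Psi i j) (S i j) \<and> vec_on (Psi i j) (L i j) \<and> mat_on (Psi i j) (l i j)) \<and>
     (\<forall>(i, j)\<in>E.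
        v j = mrestr (Psi i j) (v i) - (S i j ** herm (z i j) + z i j ** herm (S i j))
              + z i j ** l i j ** herm (z i j) \<and>
        S i j = mrestr (Psi i j) gamma ** Diag_mat (L i j)) \<and>
     (\<forall>(i, j)\<in>E. L i j - (\<Sum>k\<in>{k. (j, k) \<in> E}. vrestr (Phi j) (L j k))
                  = - s j + diag_vec (z i j ** l i j)) \<and>
     - (\<Sum>k\<in>{k. (0, k) \<in> E}. vrestr (Phi 0) (L 0 k)) = - s 0"

text \<open>
  The matrix \<open>M\<close> of line \<open>(x, y)\<close> sums, over this line and the lines downstream of \<open>y\<close>,
  the terms \<open>gamma Diag(diag(z l))\<close>.  There are two ways of bringing the term of a downstream
  line \<open>(a, b)\<close> to the phase set \<open>Psi x y\<close> when \<open>(a, b)\<close> carries fewer phases.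
  In \<open>loss_mat\<close> the loss vector \<open>diag(z l)\<close> is extended by zeros, as in the power balance, and
  then multiplied by \<open>gamma\<close> on the phases \<open>Psi x y\<close>, as in the equation for \<open>S\<close>.
  In \<open>loss_mat_padded\<close> the product, with \<open>gamma\<close> restricted to \<open>Psi a b\<close>, is extended by zeros.
  They differ in the rows of \<open>Psi x y - Psi a b\<close>, since \<open>gamma\<close> has no zero entries, and in
  general only \<open>loss_mat\<close> gives the voltage difference at every bus; \<open>loss_mat_padded\<close> gives
  it at those buses all of whose phases are carried by the downstream lines concerned.
\<close>

definition loss_mat ::
  "(nat \<times> nat) set \<Rightarrow> (nat \<Rightarrow> nat \<Rightarrow> phase set) \<Rightarrow> (nat \<Rightarrow> nat \<Rightarrow> cmat) \<Rightarrow> (nat \<Rightarrow> nat \<Rightarrow> cmat)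
    \<Rightarrow> nat \<Rightarrow> nat \<Rightarrow> cmat" where
  "loss_mat E Psi z l x y =
     mrestr (Psi x y) gamma ** Diag_mat (diag_vec (z x y ** l x y)) +
     (\<Sum>(a, b)\<in>down E y.
        mrestr (Psi x y) gamma ** Diag_mat (vrestr (Psi x y) (diag_vec (z a b ** l a b))))"

definition loss_mat_padded ::
  "(nat \<times> nat) set \<Rightarrow> (nat \<Rightarrow> nat \<Rightarrow> phase set) \<Rightarrow> (nat \<Rightarrow> nat \<Rightarrow> cmat) \<Rightarrow> (nat \<Rightarrow> nat \<Rightarrow> cmat)
    \<Rightarrow> nat \<Rightarrow> nat \<Rightarrow> cmat" where
  "loss_mat_padded E Psi z l x y =
     mrestr (Psi x y) gamma ** Diag_mat (diag_vec (z x y ** l x y)) +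
     (\<Sum>(a, b)\<in>down E y.
        mrestr (Psi x y) (mrestr (Psi a b) gamma ** Diag_mat (diag_vec (z a b ** l a b))))"

end

theory Submission
  imports Defs
begin

text \<open>
  Subtracting the two power balances, the difference \<open>L - L_hat\<close> satisfies a balance whose only
  sources are the line losses \<open>diag (z l)\<close>, so in a tree it equals the total loss on and below
  the line. Hence \<open>S - S_hat\<close> is \<open>loss_mat\<close>, and subtracting the voltage equations gives a
  recursion for \<open>v_hat - v\<close> which telescopes along the path from the root.  Restrictions
  compose along the path because phase sets shrink downstream.  In the entries indexed by
  \<open>Phi h\<close> only the rows \<open>Phi h\<close> of the loss matrices matter, and there \<open>loss_mat_padded\<close> agrees
  with \<open>loss_mat\<close> when every downstream line carries \<open>Phi h\<close>.
\<close>

section \<open>Walks in a rooted tree\<close>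

lemma walk_append:
  "walk E u (es @ fs) w \<longleftrightarrow> (\<exists>m. walk E u es m \<and> walk E m fs w)"
  by (induction es arbitrary: u) auto

lemma walk_snoc: "walk E u (es @ [e]) w \<longleftrightarrow> walk E u es (fst e) \<and> e \<in> E \<and> snd e = w"
  by (auto simp: walk_append)

lemma rooted_tree_finite: "rooted_tree N E \<Longrightarrow> finite E"
  by (rule finite_subset[of E "{0..N} \<times> {0..N}"]) (simp_all add: rooted_tree_def)

lemma rooted_tree_edge_bounds: "rooted_tree N E \<Longrightarrow> (i, j) \<in> E \<Longrightarrow> i \<le> N \<and> j \<le> N"
  unfolding rooted_tree_def by auto

lemma rooted_tree_walk_exists: "rooted_tree N E \<Longrightarrow> j \<le> N \<Longrightarrow> \<exists>es. walk E 0 es j"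
  unfolding rooted_tree_def by (auto dest!: bspec[of _ _ j])

lemma rooted_tree_walk_unique:
  "rooted_tree N E \<Longrightarrow> j \<le> N \<Longrightarrow> walk E 0 es j \<Longrightarrow> walk E 0 fs j \<Longrightarrow> es = fs"
  unfolding rooted_tree_def by (auto dest!: bspec[of _ _ j])

text \<open>Prefixing a walk from the root to \<open>u\<close> reduces this to uniqueness of root
  walks. Comparing a closed walk with \<open>[]\<close> then rules out cycles.\<close>

lemma rooted_tree_walk_unique_from:
  assumes "rooted_tree N E" "u \<le> N" "w \<le> N" "walk E u es w" "walk E u fs w"
  shows "es = fs"
proof -
  obtain ps where "walk E 0 ps u"
    using rooted_tree_walk_exists assms(1,2) by blast
  then have "walk E 0 (ps @ es) w" "walk E 0 (ps @ fs) w"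
    using assms(4,5) by (auto simp: walk_append)
  then show ?thesis
    using rooted_tree_walk_unique[OF assms(1,3)] by blast
qed

section \<open>Downstream lines and the solution of the balance recursion\<close>

lemma finite_down: "finite E \<Longrightarrow> finite (down E j)"
  by (rule finite_subset[of _ E]) (auto simp: down_def)

text \<open>Split on the first step of the walk from \<open>j\<close>: if the walk is empty, the
  line itself leaves \<open>j\<close>; otherwise the line lies below the first child.\<close>

lemma down_unfold: "down E j = (\<Union>k\<in>{k. (j, k) \<in> E}. insert (j, k) (down E k))"
proof (intro set_eqI iffI)
  fix e assume "e \<in> down E j"
  then obtain a b es where e: "e = (a, b)" "(a, b) \<in> E" "walk E j es a"
    by (auto simp: down_def)
  then show "e \<in> (\<Union>k\<in>{k. (j, k) \<in> E}. insert (j, k) (down E k))"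
    by (cases es) (auto simp: down_def)
next
  fix e assume "e \<in> (\<Union>k\<in>{k. (j, k) \<in> E}. insert (j, k) (down E k))"
  then obtain k where k: "(j, k) \<in> E" "e = (j, k) \<or> e \<in> down E k"
    by auto
  from k(2) show "e \<in> down E j"
  proof
    assume "e = (j, k)"
    moreover have "\<exists>es. walk E j es j" by (rule exI[of _ "[]"]) simp
    ultimately show ?thesis using k(1) by (simp add: down_def)
  next
    assume "e \<in> down E k"
    then obtain a b es where e: "e = (a, b)" "(a, b) \<in> E" "walk E k es a"
      by (auto simp: down_def)
    then have "walk E j ((j, k) # es) a" using k(1) by simp
    then show ?thesis using e(1,2) unfolding down_def by blast
  qed
qed

lemma edge_notin_down:
  assumes "rooted_tree N E" "(j, k') \<in> E"
  shows "(j, k) \<notin> down E k'"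
proof
  assume "(j, k) \<in> down E k'"
  then obtain es where "walk E k' es j" by (auto simp: down_def)
  then have "walk E j ((j, k') # es) j" using assms(2) by simp
  moreover have "walk E j [] j" by simp
  moreover have "j \<le> N" using rooted_tree_edge_bounds assms by blast
  ultimately show False
    using rooted_tree_walk_unique_from[OF assms(1)] by blast
qed

text \<open>A common line \<open>(a, b)\<close> would yield two walks from \<open>j\<close> to
  \<open>a\<close> that differ in their first line.\<close>

lemma down_disjoint:
  assumes "rooted_tree N E" "(j, k) \<in> E" "(j, k') \<in> E" "k \<noteq> k'"
  shows "down E k \<inter> down E k' = {}"
proof (rule ccontr)
  assume "down E k \<inter> down E k' \<noteq> {}"
  then obtain a b es fs where ab: "(a, b) \<in> E" "walk E k es a" "walk E k' fs a"
    by (auto simp: down_def)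
  then have "walk E j ((j, k) # es) a" "walk E j ((j, k') # fs) a"
    using assms by auto
  moreover have "j \<le> N" "a \<le> N" using rooted_tree_edge_bounds assms(1,2) ab(1) by blast+
  ultimately have "(j, k) # es = (j, k') # fs"
    using rooted_tree_walk_unique_from[OF assms(1)] by blast
  then show False using assms(4) by simp
qed

text \<open>The pieces of \<open>down_unfold\<close> are disjoint, so the sum over a subtree obeys
  the same recursion over children as the power balance.\<close>

lemma sum_down:
  fixes f :: "nat \<times> nat \<Rightarrow> 'a::comm_monoid_add"
  assumes "rooted_tree N E"
  shows "sum f (down E j) = (\<Sum>k\<in>{k. (j, k) \<in> E}. f (j, k) + sum f (down E k))"
proof -
  have fin: "finite E" using assms by (rule rooted_tree_finite)
  have "{k. (j, k) \<in> E} \<subseteq> snd ` E" by force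
  then have finc: "finite {k. (j, k) \<in> E}"
    using fin finite_subset by blast
  have "sum f (down E j) = (\<Sum>k\<in>{k. (j, k) \<in> E}. sum f (insert (j, k) (down E k)))"
    unfolding down_unfold[of E j]
  proof (rule sum.UNION_disjoint[OF finc])
    show "\<forall>k\<in>{k. (j, k) \<in> E}. finite (insert (j, k) (down E k))"
      using fin finite_down by auto
    show "\<forall>k\<in>{k. (j, k) \<in> E}. \<forall>k'\<in>{k. (j, k) \<in> E}. k \<noteq> k' \<longrightarrow>
        insert (j, k) (down E k) \<inter> insert (j, k') (down E k') = {}"
      using edge_notin_down[OF assms] down_disjoint[OF assms] by auto
  qed
  also have "\<dots> = (\<Sum>k\<in>{k. (j, k) \<in> E}. f (j, k) + sum f (down E k))"
    using edge_notin_down[OF assms] fin finite_down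
    by (intro sum.cong refl sum.insert) auto
  finally show ?thesis .
qed

text \<open>Induction from the leaves upwards, measured by the number of lines below
  \<open>j\<close>: passing to a child \<open>k\<close> loses at least the line
  \<open>(j, k)\<close>. At a leaf both sums are empty.\<close>

lemma balance_solution:
  fixes D d :: "nat \<Rightarrow> nat \<Rightarrow> 'a::comm_monoid_add"
  assumes tree: "rooted_tree N E"
    and balance: "\<And>i j. (i, j) \<in> E \<Longrightarrow> D i j = d i j + (\<Sum>k\<in>{k. (j, k) \<in> E}. D j k)"
    and "(i, j) \<in> E"
  shows "D i j = d i j + (\<Sum>(a, b)\<in>down E j. d a b)"
  using assms(3)
proof (induction "card (down E j)" arbitrary: i j rule: less_induct)
  case less
  have IH: "D j k = d j k + (\<Sum>(a, b)\<in>down E k. d a b)" if k: "(j, k) \<in> E" for k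
  proof (rule less.hyps[OF _ k])
    have "insert (j, k) (down E k) \<subseteq> down E j"
      using k by (subst down_unfold[of E j]) blast
    then have "down E k \<subset> down E j"
      using edge_notin_down[OF tree k] by blast
    then show "card (down E k) < card (down E j)"
      by (intro psubset_card_mono finite_down rooted_tree_finite[OF tree])
  qed
  have "(\<Sum>k\<in>{k. (j, k) \<in> E}. D j k)
      = (\<Sum>k\<in>{k. (j, k) \<in> E}. d j k + (\<Sum>(a, b)\<in>down E k. d a b))"
  proof (rule sum.cong[OF refl])
    fix k assume "k \<in> {k. (j, k) \<in> E}"
    then have "(j, k) \<in> E" by simp
    then show "D j k = d j k + (\<Sum>(a, b)\<in>down E k. d a b)" by (rule IH)
  qed
  with balance[OF less.prems]
  have "D i j = d i j + (\<Sum>k\<in>{k. (j, k) \<in> E}. d j k + (\<Sum>(a, b)\<in>down E k. d a b))"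
    by (rule trans[OF _ arg_cong[where f = "(+) (d i j)"]])
  also have "\<dots> = d i j + (\<Sum>(a, b)\<in>down E j. d a b)"
    unfolding sum_down[OF tree, of _ j] by (simp only: case_prod_conv)
  finally show ?case .
qed

section \<open>The path from the root as a set of lines\<close>

lemma path_lines_eq_set:
  assumes "rooted_tree N E" "h \<le> N" "walk E 0 es h"
  shows "path_lines E h = set es"
  unfolding path_lines_def using rooted_tree_walk_unique[OF assms(1,2,3)] assms(3) by blast

text \<open>A repeated line would close a nonempty cycle. Distinctness lets a sum over the set of
  path lines be built up one line at a time.\<close>

lemma distinct_walk:
  assumes "rooted_tree N E" "walk E u es w" "u \<le> N"
  shows "distinct es"
  using assms(2,3)
proof (induction es arbitrary: u)
  case (Cons e es)
  then have bounds: "snd e \<le> N"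
    using rooted_tree_edge_bounds[OF assms(1), of u "snd e"] by (cases e) auto
  have "e \<notin> set es"
  proof
    assume "e \<in> set es"
    then obtain as bs where "es = as @ e # bs" by (auto dest: split_list)
    then have "walk E u (e # as) u" using Cons.prems(1) by (auto simp: walk_append)
    moreover have "walk E u [] u" by simp
    ultimately show False
      using rooted_tree_walk_unique_from[OF assms(1)] Cons.prems(2) by blast
  qed
  then show ?case using Cons bounds by auto
qed simp

section \<open>Restriction, supports and column scaling\<close>

lemma mrestr_diff: "mrestr F (A - B) = mrestr F A - mrestr F B"
  by (simp add: mrestr_def vec_eq_iff)

lemma mrestr_sum: "mrestr F (\<Sum>x\<in>X. f x) = (\<Sum>x\<in>X. mrestr F (f x))"
  by (auto simp: mrestr_def vec_eq_iff)

lemma mrestr_mrestr: "F \<subseteq> G \<Longrightarrow> mrestr F (mrestr G A) = mrestr F A"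
  by (auto simp: mrestr_def vec_eq_iff)

lemma mrestr_mat_on: "mat_on F A \<Longrightarrow> mrestr F A = A"
  by (auto simp: mrestr_def mat_on_def vec_eq_iff)

lemma vrestr_vec_on: "vec_on F x \<Longrightarrow> F \<subseteq> G \<Longrightarrow> vrestr G x = x"
  by (auto simp: vrestr_def vec_on_def vec_eq_iff)

lemma mat_on_add: "mat_on F A \<Longrightarrow> mat_on F B \<Longrightarrow> mat_on F (A + B)"
  by (auto simp: mat_on_def)

lemma mat_on_diff: "mat_on F A \<Longrightarrow> mat_on F B \<Longrightarrow> mat_on F (A - B)"
  by (auto simp: mat_on_def)

lemma mat_on_mult: "mat_on F A \<Longrightarrow> mat_on F B \<Longrightarrow> mat_on F (A ** B)"
  by (auto simp: mat_on_def matrix_matrix_mult_def)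

lemma mat_on_herm: "mat_on F A \<Longrightarrow> mat_on F (herm A)"
  by (auto simp: mat_on_def herm_def)

lemma matrix_add_rdistrib: "(A + B) ** C = A ** C + B ** (C :: 'a::semiring_1 ^ 'n ^ 'm)"
  by (simp add: vec_eq_iff matrix_matrix_mult_def distrib_right sum.distrib)

lemma herm_add: "herm (A + B) = herm A + herm B"
  by (simp add: herm_def vec_eq_iff)

lemma vec_on_diag_vec: "mat_on F A \<Longrightarrow> vec_on F (diag_vec A)"
  by (auto simp: mat_on_def vec_on_def diag_vec_def)

lemma mult_Diag_mat_nth: "(A ** Diag_mat x) $ p $ q = A $ p $ q * x $ q"
  by (simp add: matrix_matrix_mult_def Diag_mat_def if_distrib cong: if_cong)

lemma mult_Diag_mat_add: "A ** Diag_mat (x + y) = A ** Diag_mat x + A ** Diag_mat y"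
  by (simp add: vec_eq_iff mult_Diag_mat_nth algebra_simps)

lemma mult_Diag_mat_sum: "A ** Diag_mat (\<Sum>i\<in>I. f i) = (\<Sum>i\<in>I. A ** Diag_mat (f i))"
  by (simp add: vec_eq_iff mult_Diag_mat_nth sum_distrib_left)

text \<open>Entry \<open>(p, q)\<close> of \<open>A ** herm Z\<close> involves only row
  \<open>p\<close> of \<open>A\<close>, and that of \<open>Z ** herm A\<close> only row
  \<open>q\<close>. So agreement on the rows in \<open>F\<close>, over all columns, is
  enough.\<close>

lemma mrestr_loss_term_cong:
  assumes "\<And>p q. p \<in> F \<Longrightarrow> A $ p $ q = B $ p $ q"
  shows "mrestr F (A ** herm Z + Z ** herm A - C) = mrestr F (B ** herm Z + Z ** herm B - C)"
  using assms by (simp add: vec_eq_iff mrestr_def matrix_matrix_mult_def herm_def)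

section \<open>Comparison of the two models\<close>

theorem lemma1:
  fixes N :: nat and E :: "(nat \<times> nat) set"
    and Phi :: "nat \<Rightarrow> phase set" and Psi :: "nat \<Rightarrow> nat \<Rightarrow> phase set"
    and z l S_hat S :: "nat \<Rightarrow> nat \<Rightarrow> cmat"
    and L_hat L :: "nat \<Rightarrow> nat \<Rightarrow> cvec"
    and v_hat v :: "nat \<Rightarrow> cmat" and v0 :: cmat
    and s :: "nat \<Rightarrow> cvec" and s0_hat s0 :: cvec
  assumes "radial_network N E Phi Psi z"
    and "linearized_model N E Phi Psi z (s(0 := s0_hat)) v_hat S_hat L_hat"
    and "intermediate_model N E Phi Psi z (s(0 := s0)) v S L l"
    and "v_hat 0 = v0" and "v 0 = v0"
  shows "(\<forall>h\<in>{1..N}.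
            v_hat h - v h =
              (\<Sum>(x, y)\<in>path_lines E h.
                 mrestr (Phi h) (loss_mat E Psi z l x y ** herm (z x y)
                                 + z x y ** herm (loss_mat E Psi z l x y)
                                 - z x y ** l x y ** herm (z x y)))) \<and>
         (\<forall>h\<in>{1..N}.
            (\<forall>(x, y)\<in>path_lines E h. \<forall>(a, b)\<in>down E y. Phi h \<subseteq> Psi a b) \<longrightarrow>
            v_hat h - v h =
              (\<Sum>(x, y)\<in>path_lines E h.
                 mrestr (Phi h) (loss_mat_padded E Psi z l x y ** herm (z x y)
                                 + z x y ** herm (loss_mat_padded E Psi z l x y)
                                 - z x y ** l x y ** herm (z x y))))"
proof -
  have tree: "rooted_tree N E"
    using assms(1) by (simp add: radial_network_def)
  have Psi_eq: "Psi i j = Phi j" and Phi_mono: "Phi j \<subseteq> Phi i" and z_on: "mat_on (Phi j) (z i j)"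
    if "(i, j) \<in> E" for i j
    using assms(1) that by (auto simp: radial_network_def)
  have l_on: "mat_on (Phi j) (l i j)" if "(i, j) \<in> E" for i j
    using assms(3) that Psi_eq[OF that] by (force simp: intermediate_model_def)
  have L_on: "vec_on (Phi j) (L i j)" "vec_on (Phi j) (L_hat i j)" if "(i, j) \<in> E" for i j
    using assms(2,3) that Psi_eq[OF that]
    by (force simp: intermediate_model_def linearized_model_def)+
  have S_eq: "S i j = mrestr (Phi j) gamma ** Diag_mat (L i j)"
      "S_hat i j = mrestr (Phi j) gamma ** Diag_mat (L_hat i j)" if "(i, j) \<in> E" for i j
    using assms(2,3) that Psi_eq[OF that]
    by (force simp: intermediate_model_def linearized_model_def)+
  have v_eq: "v j = mrestr (Phi j) (v i) - (S i j ** herm (z i j) + z i j ** herm (S i j))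
        + z i j ** l i j ** herm (z i j)"
      "v_hat j = mrestr (Phi j) (v_hat i) - (S_hat i j ** herm (z i j) + z i j ** herm (S_hat i j))"
    if "(i, j) \<in> E" for i j
    using assms(2,3) that Psi_eq[OF that]
    by (force simp: intermediate_model_def linearized_model_def)+
  define d where "d i j = diag_vec (z i j ** l i j)" for i j
  have d_on: "vec_on (Phi j) (d i j)" if "(i, j) \<in> E" for i j
    unfolding d_def by (intro vec_on_diag_vec mat_on_mult z_on l_on that)
  \<comment> \<open>The two injection functions agree only away from the slack bus, so
    \<open>s j\<close> cancels only once it is known that no line ends at the root.\<close>
  have no_root: "j \<noteq> 0" if e: "(i, j) \<in> E" for i j
  proof
    assume "j = 0"
    obtain es where "walk E 0 es i"
      using rooted_tree_walk_exists[OF tree] rooted_tree_edge_bounds[OF tree e] by blast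
    then have "walk E 0 (es @ [(i, j)]) 0" using e \<open>j = 0\<close> by (simp add: walk_snoc)
    moreover have "walk E 0 [] 0" by simp
    ultimately show False using rooted_tree_walk_unique[OF tree, of 0] by blast
  qed
  have balance: "L i j - L_hat i j = d i j + (\<Sum>k\<in>{k. (j, k) \<in> E}. L j k - L_hat j k)"
    if e: "(i, j) \<in> E" for i j
  proof -
    \<comment> \<open>Flows on child lines are supported on the smaller set \<open>Phi k\<close>, so
      the superscript in the balance is an extension by zeros and changes nothing.\<close>
    have restr: "vrestr (Phi j) (L j k) = L j k" "vrestr (Phi j) (L_hat j k) = L_hat j k"
      if "(j, k) \<in> E" for k
      using L_on[OF that] Phi_mono[OF that] vrestr_vec_on by blast+
    have "L i j = (- s j + d i j) + (\<Sum>k\<in>{k. (j, k) \<in> E}. vrestr (Phi j) (L j k))"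
      unfolding diff_eq_eq[symmetric] using assms(3) e no_root[OF e] by (fastforce simp: intermediate_model_def d_def)
    moreover have "L_hat i j = - s j + (\<Sum>k\<in>{k. (j, k) \<in> E}. vrestr (Phi j) (L_hat j k))"
      unfolding diff_eq_eq[symmetric] using assms(2) e no_root[OF e] by (fastforce simp: linearized_model_def)
    ultimately show ?thesis
      by (simp add: restr sum_subtractf)
  qed
  have downE: "(a, b) \<in> E" if "(a, b) \<in> down E y" for a b y
    using that by (auto simp: down_def)
  have walk_mono: "Phi w \<subseteq> Phi u" if "walk E u es w" for u es w
    using that by (induction es arbitrary: u) (use Phi_mono in \<open>force+\<close>)
  have down_mono: "Phi b \<subseteq> Phi y" if "(a, b) \<in> down E y" for a b y
    using that walk_mono[of y _ a] Phi_mono[of a b] by (auto simp: down_def)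
  define M where "M = loss_mat E Psi z l"
  have M_eq: "M x y = mrestr (Phi y) gamma ** Diag_mat (d x y)
      + (\<Sum>(a, b)\<in>down E y. mrestr (Phi y) gamma ** Diag_mat (d a b))" if e: "(x, y) \<in> E" for x y
  proof -
    \<comment> \<open>Phases shrink downstream, so every loss vector below \<open>y\<close> already
      lives on \<open>Phi y\<close>.\<close>
    have "vrestr (Phi y) (d a b) = d a b" if "(a, b) \<in> down E y" for a b
      using d_on[OF downE[OF that]] down_mono[OF that] by (rule vrestr_vec_on)
    then show ?thesis
      unfolding M_def loss_mat_def Psi_eq[OF e] d_def[symmetric]
      by (auto intro!: arg_cong2[where f = "(+)"] sum.cong)
  qed
  \<comment> \<open>All losses pass through the same matrix \<open>mrestr (Phi y) gamma\<close>, so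
    linearity of \<open>Diag_mat\<close> carries the solved balance over to
    \<open>S\<close>.\<close>
  have S_diff: "S x y = S_hat x y + M x y" if e: "(x, y) \<in> E" for x y
  proof -
    have "L x y = L_hat x y + (d x y + (\<Sum>(a, b)\<in>down E y. d a b))"
      using balance_solution[OF tree, of "\<lambda>i j. L i j - L_hat i j" d, OF balance e]
      by (simp add: algebra_simps)
    then show ?thesis
      unfolding S_eq[OF e] M_eq[OF e]
      by (simp add: mult_Diag_mat_add mult_Diag_mat_sum case_prod_unfold)
  qed
  define T where "T x y = M x y ** herm (z x y) + z x y ** herm (M x y)
    - z x y ** l x y ** herm (z x y)" for x y
  have M_on: "mat_on (Phi y) (M x y)" if e: "(x, y) \<in> E" for x y
    unfolding M_eq[OF e] mat_on_def
    by (auto simp: mult_Diag_mat_nth mrestr_def case_prod_unfold)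
  have T_on: "mat_on (Phi y) (T x y)" if e: "(x, y) \<in> E" for x y
    unfolding T_def
    by (intro mat_on_diff mat_on_add mat_on_mult mat_on_herm M_on z_on l_on e)
  \<comment> \<open>\<open>S\<close> enters the voltage equation with a minus sign, so the excess
    \<open>M\<close> in \<open>S\<close> appears here with a plus and the quadratic loss term with a
    minus.\<close>
  have step: "v_hat j - v j = mrestr (Phi j) (v_hat i - v i) + T i j" if e: "(i, j) \<in> E" for i j
    unfolding v_eq[OF e] S_diff[OF e] T_def
    by (simp add: mrestr_diff herm_add matrix_add_ldistrib matrix_add_rdistrib algebra_simps)
  \<comment> \<open>Induction extends the walk at its far end, as \<open>step\<close> does; the base
    case is the common slack voltage.\<close>
  have along: "v_hat h - v h = (\<Sum>(x, y)\<in>set es. mrestr (Phi h) (T x y))"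
    if "walk E 0 es h" for es h
    using that
  proof (induction es arbitrary: h rule: rev_induct)
    case Nil
    then show ?case using assms(4,5) by simp
  next
    case (snoc e es)
    obtain i where e: "e = (i, h)" "(i, h) \<in> E" and w: "walk E 0 es i"
      using snoc.prems by (cases e) (auto simp: walk_snoc)
    have "e \<notin> set es"
      using distinct_walk[OF tree snoc.prems] by simp
    then have "(\<Sum>(x, y)\<in>set (es @ [e]). mrestr (Phi h) (T x y))
        = (\<Sum>(x, y)\<in>set es. mrestr (Phi h) (T x y)) + mrestr (Phi h) (T i h)"
      by (simp add: e add.commute)
    \<comment> \<open>Restricting first to \<open>Phi i\<close> is harmless because
      \<open>Phi h\<close> is contained in it; the term of the new line is already supported on
      \<open>Phi h\<close>.\<close>
    also have "\<dots> = mrestr (Phi h) (\<Sum>(x, y)\<in>set es. mrestr (Phi i) (T x y)) + T i h"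
      using mrestr_mrestr[OF Phi_mono[OF e(2)]] mrestr_mat_on[OF T_on[OF e(2)]]
      by (simp add: mrestr_sum case_prod_unfold)
    also have "\<dots> = v_hat h - v h"
      using step[OF e(2)] snoc.IH[OF w] by simp
    finally show ?case by simp
  qed
  have main: "v_hat h - v h = (\<Sum>(x, y)\<in>path_lines E h. mrestr (Phi h) (T x y))"
    if "h \<in> {1..N}" for h
  proof -
    have "h \<le> N" using that by simp
    then obtain es where "walk E 0 es h"
      using rooted_tree_walk_exists[OF tree] by blast
    then show ?thesis
      using along path_lines_eq_set[OF tree \<open>h \<le> N\<close>] by simp
  qed
  have path: "(x, y) \<in> E \<and> Phi h \<subseteq> Phi y" if "(x, y) \<in> path_lines E h" for x y h
  proof -
    obtain es where "walk E 0 es h" "(x, y) \<in> set es"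
      using \<open>(x, y) \<in> path_lines E h\<close> by (auto simp: path_lines_def)
    then obtain as bs where "walk E 0 (as @ (x, y) # bs) h"
      by (auto dest: split_list)
    then show ?thesis using walk_mono by (auto simp: walk_append)
  qed
  have padded: "mrestr (Phi h) (T x y) = mrestr (Phi h) (loss_mat_padded E Psi z l x y ** herm (z x y)
        + z x y ** herm (loss_mat_padded E Psi z l x y) - z x y ** l x y ** herm (z x y))"
    if xy: "(x, y) \<in> path_lines E h" and sub: "\<forall>(a, b)\<in>down E y. Phi h \<subseteq> Psi a b" for x y h
    unfolding T_def
  proof (rule mrestr_loss_term_cong)
    fix p q assume p: "p \<in> Phi h"
    have e: "(x, y) \<in> E" and hy: "Phi h \<subseteq> Phi y" using path[OF xy] by auto
    have "(mrestr (Phi y) gamma ** Diag_mat (d a b)) $ p $ q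
        = mrestr (Phi y) (mrestr (Psi a b) gamma ** Diag_mat (d a b)) $ p $ q"
      if ab: "(a, b) \<in> down E y" for a b
    proof -
      have "Phi h \<subseteq> Psi a b" using sub ab by blast
      \<comment> \<open>In a row \<open>p\<close> of \<open>Phi b\<close>, restricting
        \<open>gamma\<close> to \<open>Phi b\<close> instead of \<open>Phi y\<close> alters only
        columns outside \<open>Phi b\<close>, and those are multiplied by zero entries of
        \<open>d a b\<close>.\<close>
      then have "p \<in> Phi y" "p \<in> Phi b" "Phi b \<subseteq> Phi y" "q \<in> Phi b \<or> d a b $ q = 0" "Psi a b = Phi b"
        using p hy down_mono[OF ab] d_on[OF downE[OF ab]] Psi_eq[OF downE[OF ab]]
        by (auto simp: vec_on_def)
      then show ?thesis by (auto simp: mult_Diag_mat_nth mrestr_def)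
    qed
    then show "M x y $ p $ q = loss_mat_padded E Psi z l x y $ p $ q"
      unfolding M_eq[OF e] loss_mat_padded_def Psi_eq[OF e] d_def[symmetric]
      by (auto intro!: sum.cong)
  qed
  show ?thesis
  proof (intro conjI ballI impI)
    fix h assume h: "h \<in> {1..N}"
    show "v_hat h - v h = (\<Sum>(x, y)\<in>path_lines E h.
        mrestr (Phi h) (loss_mat E Psi z l x y ** herm (z x y)
          + z x y ** herm (loss_mat E Psi z l x y) - z x y ** l x y ** herm (z x y)))"
      using main[OF h] by (simp add: T_def M_def)
    assume sub: "\<forall>(x, y)\<in>path_lines E h. \<forall>(a, b)\<in>down E y. Phi h \<subseteq> Psi a b"
    show "v_hat h - v h = (\<Sum>(x, y)\<in>path_lines E h.
        mrestr (Phi h) (loss_mat_padded E Psi z l x y ** herm (z x y)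
          + z x y ** herm (loss_mat_padded E Psi z l x y) - z x y ** l x y ** herm (z x y)))"
      unfolding main[OF h]
    proof (intro sum.cong[OF refl] prod.case_cong[OF refl] padded)
      fix e x y assume "e \<in> path_lines E h" "e = (x, y)"
      then show xy: "(x, y) \<in> path_lines E h" by simp
      show "\<forall>(a, b)\<in>down E y. Phi h \<subseteq> Psi a b"
        using sub xy by blast
    qed
  qed
qed

end
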